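(* Let $N,M$ be positive integers, let $\mathcal A,\mathcal M\in\mathbb C^{N\times N}$ with $\mathcal A$ Hermitian positive semi-definite and $\mathcal M$ Hermitian positive definite, let $\mathcal B\in\mathbb C^{N\times M}$ satisfy $\mathcal A\mathcal M^{-1}\mathcal B=0$, let $\mathcal U\in\mathbb C^{M\times M}$ be Hermitian positive definite, and let $\mathcal F\in\mathbb C^N$. Suppose $\dim\mathbb C_0=0$, and let $\alpha_1\neq\alpha_2$ be two nonzero real numbers. Then the constrained system $$\mathcal A u+\mathcal B p=\mathcal F,\qquad \mathcal B^* u=0\qquad (u\in\mathbb C^N,\ p\in\mathbb C^M)$$ has a solution $(u,p)$ whose component $u$ is unique. Moreover each of the equations $$(\mathcal A+\alpha_1\mathcal B\mathcal U\mathcal B^* )u_1=\mathcal F,\qquad (\mathcal A+\alpha_2\mathcal B\mathcal U\mathcal B^* )u_2=\mathcal F$$ has a unique solution $u_1,u_2\in\mathbb C^N$ respectively, and $$u=\frac{\alpha_1u_1-\alpha_2u_2}{\alpha_1-\alpha_2}.$$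
   Context: $X^*$ denotes the conjugate transpose of a matrix $X$. $\mathbb C_0:=\operatorname{Ker}\mathcal A\cap\operatorname{Ker}(\mathcal B\mathcal U\mathcal B^* )\subset\mathbb C^N$. *)

theory Defs
  imports "HOL-Analysis.Analysis"
begin

definition conj_transpose :: "complex^'c^'r \<Rightarrow> complex^'r^'c" where
  "conj_transpose X = (\<chi> i j. cnj (X $ j $ i))"

definition hermitian :: "complex^'k^'k \<Rightarrow> bool" where
  "hermitian X \<longleftrightarrow> conj_transpose X = X"

text \<open>The number \<open>x\<^sup>* X x\<close>.  It is real whenever \<open>X\<close> is Hermitian, so that taking its real
  part in the two definitions below only changes the type from \<^typ>\<open>complex\<close> to \<^typ>\<open>real\<close>.\<close>

definition quad_form :: "complex^'k^'k \<Rightarrow> complex^'k \<Rightarrow> complex" where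
  "quad_form X x = (\<Sum>i\<in>UNIV. cnj (x $ i) * (X *v x) $ i)"

lemma hermitian_quad_form_real:
  assumes "hermitian X"
  shows "quad_form X x \<in> \<real>"
proof -
  have X: "cnj (X $ i $ j) = X $ j $ i" for i j
  proof -
    have "X $ j $ i = conj_transpose X $ j $ i"
      using assms by (simp only: hermitian_def)
    then show ?thesis
      by (simp only: conj_transpose_def vec_lambda_beta)
  qed
  have form: "quad_form X x = (\<Sum>i\<in>UNIV. \<Sum>j\<in>UNIV. cnj (x $ i) * X $ i $ j * x $ j)"
    by (simp add: quad_form_def matrix_vector_mult_def sum_distrib_left mult.assoc)
  have "cnj (quad_form X x) = (\<Sum>i\<in>UNIV. \<Sum>j\<in>UNIV. cnj (x $ j) * X $ j $ i * x $ i)"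
    unfolding form cnj_sum complex_cnj_mult complex_cnj_cnj X by (simp only: ac_simps)
  also have "\<dots> = quad_form X x"
    unfolding form by (rule sum.swap)
  finally show ?thesis
    by (simp only: Reals_cnj_iff)
qed

definition hermitian_pos_semidef :: "complex^'k^'k \<Rightarrow> bool" where
  "hermitian_pos_semidef X \<longleftrightarrow> hermitian X \<and> (\<forall>x. 0 \<le> Re (quad_form X x))"

definition hermitian_pos_def :: "complex^'k^'k \<Rightarrow> bool" where
  "hermitian_pos_def X \<longleftrightarrow> hermitian X \<and> (\<forall>x. x \<noteq> 0 \<longrightarrow> 0 < Re (quad_form X x))"

definition matrix_ker :: "complex^'c^'r \<Rightarrow> (complex^'c) set" where
  "matrix_ker X = {x. X *v x = 0}"

definition C0 :: "complex^'n^'n \<Rightarrow> complex^'m^'n \<Rightarrow> complex^'m^'m \<Rightarrow> (complex^'n) set" where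
  "C0 A B U = matrix_ker A \<inter> matrix_ker (B ** U ** conj_transpose B)"

definition constrained_solution ::
  "complex^'n^'n \<Rightarrow> complex^'m^'n \<Rightarrow> complex^'n \<Rightarrow> complex^'n \<Rightarrow> complex^'m \<Rightarrow> bool" where
  "constrained_solution A B F u p \<longleftrightarrow> A *v u + B *v p = F \<and> conj_transpose B *v u = 0"

end

theory Submission
  imports Defs
begin

(* With S = B U B*, both the constrained system and (A + alpha S) v = F have the form
   A v + B q = F.  The hypothesis A M^-1 B = 0 makes Ran A and Ran B orthogonal for the inner
   product given by M^-1, so A v is determined by F alone.  Hence A u1 = A u2 and
   alpha1 S u1 = alpha2 S u2, and the combination v = (alpha1 u1 - alpha2 u2) / (alpha1 - alpha2)
   satisfies A v = A u1 and S v = 0; since U is definite, B* v = 0. *)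

lemma matrix_vector_mult_scaleR_complex:
  fixes X :: "complex^'c^'r"
  shows "X *v (k *\<^sub>R x) = k *\<^sub>R (X *v x)"
  by (simp add: vec_eq_iff matrix_vector_mult_def scaleR_sum_right)

lemma scaleR_matrix_vector_mult_complex:
  fixes X :: "complex^'c^'r"
  shows "(k *\<^sub>R X) *v x = k *\<^sub>R (X *v x)"
  by (simp add: vec_eq_iff matrix_vector_mult_def scaleR_sum_right)

text \<open>Adjointness for the standard Hermitian inner product, spelled out as sums to match
  \<open>quad_form\<close>. It is applied to the square \<open>A\<close> and to the rectangular
  \<open>conj_transpose B\<close>.\<close>

lemma cnj_inner_matrix_vector:
  fixes X :: "complex^'c^'r"
  shows "(\<Sum>i\<in>UNIV. cnj (x $ i) * (X *v y) $ i)
    = (\<Sum>j\<in>UNIV. cnj ((conj_transpose X *v x) $ j) * y $ j)"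
proof -
  have "(\<Sum>i\<in>UNIV. cnj (x $ i) * (X *v y) $ i)
      = (\<Sum>i\<in>UNIV. \<Sum>j\<in>UNIV. cnj (x $ i) * X $ i $ j * y $ j)"
    by (simp add: matrix_vector_mult_def sum_distrib_left mult.assoc)
  also have "\<dots> = (\<Sum>j\<in>UNIV. \<Sum>i\<in>UNIV. cnj (x $ i) * X $ i $ j * y $ j)"
    by (rule sum.swap)
  also have "\<dots> = (\<Sum>j\<in>UNIV. cnj ((conj_transpose X *v x) $ j) * y $ j)"
    by (simp add: matrix_vector_mult_def conj_transpose_def sum_distrib_left sum_distrib_right ac_simps)
  finally show ?thesis .
qed

lemma hermitian_pos_def_quad_form_eq_0D:
  assumes "hermitian_pos_def X" "quad_form X x = 0"
  shows "x = 0"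
  using assms by (force simp: hermitian_pos_def_def)

lemma square_matrix_invertible:
  fixes X :: "complex^'n^'n"
  assumes "\<And>x. X *v x = 0 \<Longrightarrow> x = 0"
  shows "invertible X"
  using assms matrix_left_invertible_ker invertible_left_inverse by blast

lemma square_matrix_unique_solution:
  fixes X :: "complex^'n^'n"
  assumes "\<And>x. X *v x = 0 \<Longrightarrow> x = 0"
  shows "\<exists>!x. X *v x = F"
proof -
  obtain Y where Y: "X ** Y = mat 1" "Y ** X = mat 1"
    using square_matrix_invertible[OF assms] by (auto simp: invertible_def)
  show ?thesis
  proof
    show "X *v (Y *v F) = F"
      by (simp add: matrix_vector_mul_assoc Y)
    show "x = Y *v F" if "X *v x = F" for x
      by (simp flip: that add: matrix_vector_mul_assoc Y)
  qed
qed

text \<open>\<open>matrix_inv\<close> is a choice term, informative only once some inverse exists;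
  definiteness makes the kernel trivial and so supplies one.\<close>

lemma hermitian_pos_def_matrix_inv_right:
  assumes "hermitian_pos_def X"
  shows "X ** matrix_inv X = mat 1"
proof -
  have "x = 0" if "X *v x = 0" for x
    using hermitian_pos_def_quad_form_eq_0D[OF assms] that by (simp add: quad_form_def)
  then obtain Y where "X ** Y = mat 1 \<and> Y ** X = mat 1"
    using square_matrix_invertible[of X] by (auto simp: invertible_def)
  then show ?thesis
    unfolding matrix_inv_def by (rule someI2) simp
qed

text \<open>Multiplying the equation by \<open>A ** matrix_inv M\<close> kills the \<open>B\<close>
  term. What remains says that \<open>A\<close> annihilates \<open>z\<close>, the preimage of
  \<open>A *v x\<close> under \<open>M\<close>, and definiteness of \<open>M\<close> then forces
  \<open>z = 0\<close>.\<close>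

lemma ranges_independent:
  fixes A M :: "complex^'n^'n" and B :: "complex^'m^'n"
  assumes A: "hermitian A" and M: "hermitian_pos_def M"
    and AMB: "A ** matrix_inv M ** B = 0" and eq: "A *v x + B *v q = 0"
  shows "A *v x = 0"
proof -
  define z where "z = matrix_inv M *v (A *v x)"
  have Mz: "M *v z = A *v x"
    unfolding z_def using hermitian_pos_def_matrix_inv_right[OF M]
    by (simp add: matrix_vector_mul_assoc matrix_mul_assoc)
  have "A *v z + (A ** matrix_inv M ** B) *v q = (A ** matrix_inv M) *v (A *v x + B *v q)"
    unfolding z_def by (simp add: matrix_vector_right_distrib matrix_vector_mul_assoc matrix_mul_assoc)
  then have "A *v z = 0"
    by (simp add: AMB eq)
  \<comment> \<open>z* M z = z* A x = (A z)* x = 0, moving the Hermitian \<open>A\<close> to the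
    left factor.\<close>
  then have "quad_form M z = 0"
    using A cnj_inner_matrix_vector[of z A x] by (simp add: quad_form_def Mz hermitian_def)
  then show ?thesis
    using hermitian_pos_def_quad_form_eq_0D[OF M] Mz by fastforce
qed

text \<open>With y = B* x, the assumption reads B U y = 0, so (U y)* y = (B U y)* x = 0. This is the
  conjugate of y* U y, and \<open>U\<close> is definite.\<close>

lemma conj_transpose_kernel:
  fixes B :: "complex^'m^'n"
  assumes U: "hermitian_pos_def U" and eq: "(B ** U ** conj_transpose B) *v x = 0"
  shows "conj_transpose B *v x = 0"
proof (rule hermitian_pos_def_quad_form_eq_0D[OF U])
  let ?y = "conj_transpose B *v x"
  have "conj_transpose (conj_transpose B) = B"
    by (simp add: conj_transpose_def vec_eq_iff)
  moreover have "B *v (U *v ?y) = 0"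
    using eq by (simp add: matrix_vector_mul_assoc matrix_mul_assoc)
  ultimately have "(\<Sum>i\<in>UNIV. cnj ((U *v ?y) $ i) * ?y $ i) = 0"
    using cnj_inner_matrix_vector[of "U *v ?y" "conj_transpose B" x] by simp
  then have "cnj (quad_form U ?y) = 0"
    by (simp add: quad_form_def mult.commute)
  then show "quad_form U ?y = 0"
    by simp
qed

theorem mainTheorem3:
  fixes A M :: "complex^'n^'n" and B :: "complex^'m^'n" and U :: "complex^'m^'m"
    and F :: "complex^'n" and \<alpha>1 \<alpha>2 :: real
  assumes "hermitian_pos_semidef A"
    and "hermitian_pos_def M"
    and "A ** matrix_inv M ** B = 0"
    and "hermitian_pos_def U"
    and "vec.dim (C0 A B U) = 0"
    and "\<alpha>1 \<noteq> 0" and "\<alpha>2 \<noteq> 0" and "\<alpha>1 \<noteq> \<alpha>2"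
  shows "(\<exists>!u. \<exists>p. constrained_solution A B F u p)
    \<and> (\<exists>!u1. (A + \<alpha>1 *\<^sub>R (B ** U ** conj_transpose B)) *v u1 = F)
    \<and> (\<exists>!u2. (A + \<alpha>2 *\<^sub>R (B ** U ** conj_transpose B)) *v u2 = F)
    \<and> (\<forall>u p u1 u2. constrained_solution A B F u p
          \<and> (A + \<alpha>1 *\<^sub>R (B ** U ** conj_transpose B)) *v u1 = F
          \<and> (A + \<alpha>2 *\<^sub>R (B ** U ** conj_transpose B)) *v u2 = F
        \<longrightarrow> u = (\<alpha>1 *\<^sub>R u1 - \<alpha>2 *\<^sub>R u2) /\<^sub>R (\<alpha>1 - \<alpha>2))"
proof -
  define S where "S = B ** U ** conj_transpose B"
  \<comment> \<open>\<open>\<alpha> *\<^sub>R R x\<close> takes the place of the multiplier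
    \<open>p\<close> when the regularized equation is read as A x + B p = F.\<close>
  define R where "R x = U *v (conj_transpose B *v x)" for x
  have SR: "S *v x = B *v R x" for x
    by (simp add: S_def R_def matrix_vector_mul_assoc matrix_mul_assoc)
  have expand: "(A + \<alpha> *\<^sub>R S) *v x = A *v x + B *v (\<alpha> *\<^sub>R R x)" for \<alpha> x
    by (simp add: matrix_vector_mult_add_rdistrib scaleR_matrix_vector_mult_complex
        matrix_vector_mult_scaleR_complex SR)
  have indep: "A *v x = 0" if "A *v x + B *v q = 0" for x q
    using ranges_independent[OF _ assms(2,3) that] assms(1) by (simp add: hermitian_pos_semidef_def)
  have indep_diff: "A *v x = A *v y" if "A *v x + B *v p = F" "A *v y + B *v q = F" for x y p q
    using indep[of "x - y" "p - q"] that by (simp add: matrix_vector_mult_diff_distrib algebra_simps)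
  \<comment> \<open>Dimension 0 confines \<open>C0 A B U\<close> to the zero vector.\<close>
  have ker: "x = 0" if "A *v x = 0" "S *v x = 0" for x
    using assms(5) that by (auto simp: C0_def matrix_ker_def S_def)
  \<comment> \<open>A negative \<open>\<alpha>\<close> rules out a positivity argument; instead
    \<open>indep\<close> makes both summands vanish separately on the kernel.\<close>
  have reg: "\<exists>!x. (A + \<alpha> *\<^sub>R S) *v x = F" if "\<alpha> \<noteq> 0" for \<alpha>
  proof (rule square_matrix_unique_solution)
    fix x assume 0: "(A + \<alpha> *\<^sub>R S) *v x = 0"
    then have "A *v x = 0"
      using indep by (simp add: expand)
    moreover from this have "S *v x = 0"
      using 0 that by (simp add: expand matrix_vector_mult_scaleR_complex SR)
    ultimately show "x = 0"
      by (rule ker)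
  qed
  \<comment> \<open>The multipliers may differ, since \<open>B\<close> may have a kernel.\<close>
  have uniq: "u = v" if "constrained_solution A B F u p" "constrained_solution A B F v q" for u v p q
  proof -
    have "A *v (u - v) = 0"
      using that indep_diff[of u p v q] by (simp add: constrained_solution_def matrix_vector_mult_diff_distrib)
    moreover have "S *v (u - v) = 0"
      using that by (simp add: SR R_def constrained_solution_def matrix_vector_mult_diff_distrib)
    ultimately show ?thesis
      using ker by fastforce
  qed
  \<comment> \<open>The multiplier of \<open>u1\<close> is reused: the combination has the same
    image under \<open>A\<close> as \<open>u1\<close>, hence leaves the same remainder for
    \<open>B\<close>.\<close>
  have sol: "constrained_solution A B F ((\<alpha>1 *\<^sub>R u1 - \<alpha>2 *\<^sub>R u2) /\<^sub>R (\<alpha>1 - \<alpha>2)) (\<alpha>1 *\<^sub>R R u1)"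
    if u1: "(A + \<alpha>1 *\<^sub>R S) *v u1 = F" and u2: "(A + \<alpha>2 *\<^sub>R S) *v u2 = F" for u1 u2
  proof -
    let ?v = "(\<alpha>1 *\<^sub>R u1 - \<alpha>2 *\<^sub>R u2) /\<^sub>R (\<alpha>1 - \<alpha>2)"
    have eq: "A *v u1 = A *v u2"
      using indep_diff u1 u2 by (simp add: expand)
    then have "\<alpha>1 *\<^sub>R (S *v u1) = \<alpha>2 *\<^sub>R (S *v u2)"
      using u1 u2 by (auto simp: matrix_vector_mult_add_rdistrib scaleR_matrix_vector_mult_complex)
    then have "S *v ?v = 0"
      by (simp add: matrix_vector_mult_scaleR_complex matrix_vector_mult_diff_distrib)
    then have "conj_transpose B *v ?v = 0"
      using conj_transpose_kernel[OF assms(4)] by (simp add: S_def)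
    \<comment> \<open>As \<open>A\<close> takes equal values at \<open>u1\<close> and
      \<open>u2\<close>, only the sum of the two weights matters, and it is 1.\<close>
    moreover have "A *v ?v = A *v u1"
      using assms(8) by (simp add: matrix_vector_mult_scaleR_complex matrix_vector_mult_diff_distrib
          flip: eq scaleR_left_diff_distrib)
    ultimately show ?thesis
      using u1 by (simp add: constrained_solution_def expand)
  qed
  \<comment> \<open>Solvability of the constrained system is read off from the extrapolation formula
    itself; \<open>uniq\<close> then gives the formula for every solution.\<close>
  obtain u1 u2 where "(A + \<alpha>1 *\<^sub>R S) *v u1 = F" "(A + \<alpha>2 *\<^sub>R S) *v u2 = F"
    using reg assms(6,7) by metis
  then have "\<exists>!u. \<exists>p. constrained_solution A B F u p"
    using sol uniq by metis
  then show ?thesis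
    using reg assms(6,7) sol uniq unfolding S_def by blast
qed

end
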